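(* Let $(S,N)$ be a quadratic normalisation of class $(4,3)$ mod $1$ for a monoid $M$. Then $\overline{N}$ is a local factorability structure on $(M,S)$.
   Context: Notation. $S$ is a generating subset of $M$ containing $1$ (the $N$-neutral letter is identified with $1\in M$), $S_+=S\setminus\{1\}$. $S^*$ is the free monoid over $S$; words are written $(s_1,\ldots,s_n)=s_1|\cdots|s_n$; $|w|$ is the length of $w$. For $F:A^2\to A^2$, $F_i$ applies $F$ to the entries at positions $i,i+1$ of a word over $A$ (from the left). Compositions are read with the rightmost map applied first. Normalisation. A normalisation is a pair $(A,N)$ with $N:A^*\to A^*$ length-preserving, identity on one-letter words, and $N(u|v|w)=N(u|N(v)|w)$ for all words $u,v,w$; $w$ is $N$-normal if $N(w)=w$; $\overline{N}:A^2\to A^2$ is the restriction of $N$ to length-two words. $(A,N)$ is quadratic if a word is $N$-normal iff all its length-two factors are, and for each word $w$ there is a finite sequence of positions $(i_1,\ldots,i_k)$ with $N(w)=\overline{N}_{i_k}\cdots\overline{N}_{i_1}(w)$. $e\in A$ is $N$-neutral if $N(w|e)=N(e|w)=N(w)|e$ for all $w$. $(S,N)$ is a normalisation mod $1$ for $M$ if $1\in S$ is $N$-neutral and $M$ is presented (via the inclusion $S\subseteq M$) by $\langle S\mid\{w=N(w):w\in S^*\}\cup\{1_S=1\}\rangle$, where $1_S$ is the letter $1$ of $S$. Class. A quadratic normalisation is of left-class $m$ (resp. right-class $n$) if for every length-three word $w$, $N(w)$ is obtained from $w$ by applying alternately $\overline{N}_1,\overline{N}_2,\ldots$ ($m$ maps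 in total, $\overline{N}_1$ first) (resp. $\overline{N}_2,\overline{N}_1,\ldots$, $n$ maps in total, $\overline{N}_2$ first). Class $(m,n)$ means left-class $m$ and right-class $n$. Local factorability. For $\varphi:S^2\to S^2$ and $w\in S^*$ put $T_\varphi(w)=\varphi_{|w|-1}\cdots\varphi_1(w)$ ($T_\varphi(w)=w$ if $|w|=1$). $N_\varphi:S^*\to S^*$ is defined recursively: $N_\varphi$ of the empty word is empty; $N_\varphi$ of a word containing $1$ equals $N_\varphi$ of the word with $1$ removed; for $s_1,\ldots,s_n\in S_+$, putting $v=T_\varphi(s_1|N_\varphi(s_2,\ldots,s_n))$, $N_\varphi(s_1,\ldots,s_n)=v$ if $v$ contains no $1$, and $=N_\varphi(v)$ otherwise. A local factorability structure on $(M,S)$ is a map $\varphi:S^2\to S^2$ such that: (1) $M$ admits the presentation $\langle S_+\mid\{(s,t)=\varphi(s,t):s,t\in S_+\}\rangle$ (letters $1$ occurring in $\varphi(s,t)$ being read as the empty word); (2) $\varphi$ is idempotent; (3) $\varphi(1,s)=(s,1)$ for every $s\in S_+$; (4) for every $(r,s,t)\in S_+^3$, either $\varphi_1\varphi_2\varphi_1\varphi_2(r,s,t)=\varphi_2\varphi_1\varphi_2(r,s,t)$ or $\varphi_2\varphi_1\varphi_2(r,s,t)$ contains $1$; (5) $N_\varphi(r,s,t)=N_\varphi(\varphi_1(r,s,t))$ for every $(r,s,t)\in S^3$. *)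

theory Defs
  imports "HOL-Algebra.Group"
begin

text \<open>Words over \<open>A\<close> are the elements of \<open>lists A\<close>.\<close>

definition word_value :: "('a, 'b) monoid_scheme \<Rightarrow> 'a list \<Rightarrow> 'a" where
  "word_value M w = foldr (\<otimes>\<^bsub>M\<^esub>) w \<one>\<^bsub>M\<^esub>"

definition generates :: "('a, 'b) monoid_scheme \<Rightarrow> 'a set \<Rightarrow> bool" where
  "generates M S \<longleftrightarrow> S \<subseteq> carrier M \<and> (\<forall>H. submonoid H M \<longrightarrow> S \<subseteq> H \<longrightarrow> H = carrier M)"

inductive word_cong :: "'a set \<Rightarrow> ('a list \<times> 'a list) set \<Rightarrow> 'a list \<Rightarrow> 'a list \<Rightarrow> bool"
  for X :: "'a set" and R :: "('a list \<times> 'a list) set"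
where
  rel: "(u, v) \<in> R \<Longrightarrow> word_cong X R u v"
| refl: "w \<in> lists X \<Longrightarrow> word_cong X R w w"
| sym: "word_cong X R u v \<Longrightarrow> word_cong X R v u"
| trans: "word_cong X R u v \<Longrightarrow> word_cong X R v w \<Longrightarrow> word_cong X R u w"
| append: "word_cong X R u u' \<Longrightarrow> word_cong X R v v' \<Longrightarrow> word_cong X R (u @ v) (u' @ v')"

text \<open>\<open>M\<close> is presented by \<open>\<langle>X | R\<rangle>\<close> via the inclusion \<open>X \<subseteq> M\<close>: evaluation of words induces an
  isomorphism from the quotient of the free monoid over \<open>X\<close> onto \<open>M\<close>.\<close>

definition presented_by ::
  "('a, 'b) monoid_scheme \<Rightarrow> 'a set \<Rightarrow> ('a list \<times> 'a list) set \<Rightarrow> bool" where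
  "presented_by M X R \<longleftrightarrow>
     X \<subseteq> carrier M \<and> R \<subseteq> lists X \<times> lists X \<and>
     word_value M ` lists X = carrier M \<and>
     (\<forall>u\<in>lists X. \<forall>v\<in>lists X. word_value M u = word_value M v \<longleftrightarrow> word_cong X R u v)"

text \<open>\<open>F\<^sub>i\<close>, where positions are counted from 1; meaningful for \<open>1 \<le> i < length w\<close>.\<close>

definition app_at :: "('a \<times> 'a \<Rightarrow> 'a \<times> 'a) \<Rightarrow> nat \<Rightarrow> 'a list \<Rightarrow> 'a list" where
  "app_at F i w = (let (a, b) = F (w ! (i - 1), w ! i) in w[i - 1 := a, i := b])"

text \<open>\<open>app_seq F [i\<^sub>1, \<dots>, i\<^sub>k]\<close> applies \<open>F\<close> at position \<open>i\<^sub>1\<close> first and at position \<open>i\<^sub>k\<close> last.\<close>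

definition app_seq :: "('a \<times> 'a \<Rightarrow> 'a \<times> 'a) \<Rightarrow> nat list \<Rightarrow> 'a list \<Rightarrow> 'a list" where
  "app_seq F is w = fold (app_at F) is w"

locale normalisation =
  fixes A :: "'a set" and N :: "'a list \<Rightarrow> 'a list"
  assumes closed: "w \<in> lists A \<Longrightarrow> N w \<in> lists A"
    and length_preserving: "w \<in> lists A \<Longrightarrow> length (N w) = length w"
    and letter: "a \<in> A \<Longrightarrow> N [a] = [a]"
    and factor: "\<lbrakk>u \<in> lists A; v \<in> lists A; w \<in> lists A\<rbrakk> \<Longrightarrow> N (u @ v @ w) = N (u @ N v @ w)"

definition Nbar :: "('a list \<Rightarrow> 'a list) \<Rightarrow> 'a \<times> 'a \<Rightarrow> 'a \<times> 'a" where
  "Nbar N = (\<lambda>(s, t). (N [s, t] ! 0, N [s, t] ! 1))"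

locale quadratic_normalisation = normalisation +
  assumes normal_iff: "w \<in> lists A \<Longrightarrow>
      N w = w \<longleftrightarrow> (\<forall>u x y v. w = u @ [x, y] @ v \<longrightarrow> N [x, y] = [x, y])"
    and by_positions: "w \<in> lists A \<Longrightarrow>
      \<exists>is. set is \<subseteq> {1..<length w} \<and> N w = app_seq (Nbar N) is w"

definition alternating :: "nat \<Rightarrow> nat \<Rightarrow> nat \<Rightarrow> nat list" where
  "alternating i j m = map (\<lambda>k. if even k then i else j) [0..<m]"

definition left_class :: "'a set \<Rightarrow> ('a list \<Rightarrow> 'a list) \<Rightarrow> nat \<Rightarrow> bool" where
  "left_class A N m \<longleftrightarrow>
     (\<forall>w\<in>lists A. length w = 3 \<longrightarrow> N w = app_seq (Nbar N) (alternating 1 2 m) w)"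

definition right_class :: "'a set \<Rightarrow> ('a list \<Rightarrow> 'a list) \<Rightarrow> nat \<Rightarrow> bool" where
  "right_class A N n \<longleftrightarrow>
     (\<forall>w\<in>lists A. length w = 3 \<longrightarrow> N w = app_seq (Nbar N) (alternating 2 1 n) w)"

definition of_class :: "'a set \<Rightarrow> ('a list \<Rightarrow> 'a list) \<Rightarrow> nat \<Rightarrow> nat \<Rightarrow> bool" where
  "of_class A N m n \<longleftrightarrow> left_class A N m \<and> right_class A N n"

definition neutral :: "'a set \<Rightarrow> ('a list \<Rightarrow> 'a list) \<Rightarrow> 'a \<Rightarrow> bool" where
  "neutral A N e \<longleftrightarrow>
     e \<in> A \<and> (\<forall>w\<in>lists A. N (w @ [e]) = N w @ [e] \<and> N (e # w) = N w @ [e])"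

definition normalisation_mod_1 ::
  "('a, 'b) monoid_scheme \<Rightarrow> 'a set \<Rightarrow> ('a list \<Rightarrow> 'a list) \<Rightarrow> bool" where
  "normalisation_mod_1 M S N \<longleftrightarrow>
     normalisation S N \<and> neutral S N \<one>\<^bsub>M\<^esub> \<and>
     presented_by M S ({(w, N w) |w. w \<in> lists S} \<union> {([\<one>\<^bsub>M\<^esub>], [])})"

text \<open>\<open>T\<^sub>\<phi> = \<phi>\<^bsub>|w|-1\<^esub> \<circ> \<dots> \<circ> \<phi>\<^sub>1\<close>\<close>

definition sweep :: "('a \<times> 'a \<Rightarrow> 'a \<times> 'a) \<Rightarrow> 'a list \<Rightarrow> 'a list" where
  "sweep \<phi> w = app_seq \<phi> [1..<length w] w"

lemma length_app_seq: "length (app_seq F is w) = length w"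
  unfolding app_seq_def
  by (induction "is" arbitrary: w) (simp_all add: app_at_def Let_def split: prod.split)

lemma length_sweep: "length (sweep \<phi> w) = length w"
  by (simp add: sweep_def length_app_seq)

text \<open>\<open>N\<^sub>\<phi>\<close>, with the letter \<open>e\<close> in the role of \<open>1\<close>.\<close>

function Nphi :: "'a \<Rightarrow> ('a \<times> 'a \<Rightarrow> 'a \<times> 'a) \<Rightarrow> 'a list \<Rightarrow> 'a list" where
  "Nphi e \<phi> [] = []"
| "Nphi e \<phi> (s # ws) =
     (if e \<in> set (s # ws) then Nphi e \<phi> (removeAll e (s # ws))
      else let v = sweep \<phi> (s # Nphi e \<phi> ws)
           in if e \<in> set v then Nphi e \<phi> v else v)"
  by pat_completeness auto

lemma length_Nphi_dom: "Nphi_dom (e, \<phi>, w) \<Longrightarrow> length (Nphi e \<phi> w) \<le> length (removeAll e w)"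
proof (induction rule: Nphi.pinduct)
  case (1 e \<phi>)
  then show ?case by (simp add: Nphi.psimps)
next
  case (2 e \<phi> s ws)
  show ?case
  proof (cases "e \<in> set (s # ws)")
    case True
    then show ?thesis
      using 2(2)[OF True] by (simp add: Nphi.psimps(2)[OF 2(1)] del: removeAll.simps)
  next
    case False
    define v where "v = sweep \<phi> (s # Nphi e \<phi> ws)"
    have ws: "removeAll e (s # ws) = s # ws" "removeAll e ws = ws"
      using False by auto
    have len: "length v \<le> length (s # ws)"
      using 2(3)[OF False] by (simp add: v_def length_sweep ws)
    show ?thesis
    proof (cases "e \<in> set v")
      case True
      have "length (Nphi e \<phi> v) \<le> length (removeAll e v)"
        by (rule 2(4)[OF False v_def True])
      also have "\<dots> \<le> length v"
        by (simp add: removeAll_filter_not_eq)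
      finally show ?thesis
        using False True len ws
        by (simp add: Nphi.psimps(2)[OF 2(1)] v_def[symmetric] Let_def del: removeAll.simps)
    next
      case notin: False
      show ?thesis
        using False notin len ws
        by (simp add: Nphi.psimps(2)[OF 2(1)] v_def[symmetric] Let_def del: removeAll.simps)
    qed
  qed
qed

termination Nphi
proof (relation "measures [\<lambda>(e, \<phi>, w). length (removeAll e w), \<lambda>(e, \<phi>, w). length w]",
    goal_cases)
  case 1
  then show ?case by simp
next
  case (2 e \<phi> s ws)
  then show ?case
    using length_removeAll_less[of e "s # ws"] by (simp del: removeAll.simps)
next
  case (3 e \<phi> s ws)
  then show ?case by simp
next
  case (4 e \<phi> s ws v)
  have "length v = Suc (length (Nphi e \<phi> ws))"
    by (simp add: 4(2) length_sweep)
  moreover have "length (Nphi e \<phi> ws) \<le> length (removeAll e ws)"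
    by (rule length_Nphi_dom[OF 4(4)])
  moreover have "length (removeAll e v) < length v"
    using 4(3) by (rule length_removeAll_less)
  ultimately show ?case using 4(1) by simp
qed

text \<open>The relations in \<open>presentation\<close> read the letters \<open>1\<close> of \<open>\<phi> (s, t)\<close> as the empty word.
  Since position lists start with the map applied first, \<open>[2, 1, 2, 1]\<close> encodes
  \<open>\<phi>\<^sub>1 \<circ> \<phi>\<^sub>2 \<circ> \<phi>\<^sub>1 \<circ> \<phi>\<^sub>2\<close>.\<close>

locale local_factorability =
  fixes M :: "('a, 'b) monoid_scheme" and S :: "'a set" and \<phi> :: "'a \<times> 'a \<Rightarrow> 'a \<times> 'a"
  assumes maps_to: "\<phi> \<in> S \<times> S \<rightarrow> S \<times> S"
    and presentation: "presented_by M (S - {\<one>\<^bsub>M\<^esub>})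
      {([s, t], removeAll \<one>\<^bsub>M\<^esub> [fst (\<phi> (s, t)), snd (\<phi> (s, t))])
        |s t. s \<in> S - {\<one>\<^bsub>M\<^esub>} \<and> t \<in> S - {\<one>\<^bsub>M\<^esub>}}"
    and idempotent: "p \<in> S \<times> S \<Longrightarrow> \<phi> (\<phi> p) = \<phi> p"
    and one_left: "s \<in> S - {\<one>\<^bsub>M\<^esub>} \<Longrightarrow> \<phi> (\<one>\<^bsub>M\<^esub>, s) = (s, \<one>\<^bsub>M\<^esub>)"
    and triple: "\<lbrakk>r \<in> S - {\<one>\<^bsub>M\<^esub>}; s \<in> S - {\<one>\<^bsub>M\<^esub>}; t \<in> S - {\<one>\<^bsub>M\<^esub>}\<rbrakk> \<Longrightarrow>
      app_seq \<phi> [2, 1, 2, 1] [r, s, t] = app_seq \<phi> [2, 1, 2] [r, s, t] \<or>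
      \<one>\<^bsub>M\<^esub> \<in> set (app_seq \<phi> [2, 1, 2] [r, s, t])"
    and Nphi_app: "\<lbrakk>r \<in> S; s \<in> S; t \<in> S\<rbrakk> \<Longrightarrow>
      Nphi \<one>\<^bsub>M\<^esub> \<phi> [r, s, t] = Nphi \<one>\<^bsub>M\<^esub> \<phi> (app_at \<phi> 1 [r, s, t])"

end

theory Submission
  imports Defs
begin

text \<open>Right-class 3 is a domino rule: if \<open>x\<close> is normal, one sweep from left to right turns
  \<open>s # x\<close> into \<open>N (s # x)\<close>. Since \<open>1\<close> is neutral, \<open>N\<close> moves all letters \<open>1\<close> to the end, so the
  recursion defining \<open>Nphi\<close> computes \<open>N\<close> followed by the deletion of the letters \<open>1\<close>. Condition (5)
  is then the invariance of \<open>N\<close> under normalising a factor.\<close>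

section \<open>Positions in words and sweeps\<close>

lemma app_at_append:
  "app_at F (Suc (length a)) (a @ s # t # b) = a @ fst (F (s, t)) # snd (F (s, t)) # b"
  by (simp add: app_at_def nth_append list_update_append split: prod.split)

text \<open>Positions count from 1: at 0 the truncated \<open>i - 1\<close> would pair a letter with
  itself, so the shift by one fails there.\<close>

lemma app_at_Cons: "0 < i \<Longrightarrow> app_at F (Suc i) (a # w) = a # app_at F i w"
  by (cases i) (simp_all add: app_at_def split: prod.split)

lemma split_at_position:
  assumes "i \<in> {1..<length w}"
  obtains a s t b where "w = a @ s # t # b" "i = Suc (length a)"
proof -
  obtain j where j: "i = Suc j" using assms by (cases i) auto
  show ?thesis
  proof
    show "w = take j w @ w ! j # w ! Suc j # drop (Suc (Suc j)) w"
      using assms j by (simp add: Cons_nth_drop_Suc)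
    show "i = Suc (length (take j w))" using assms j by simp
  qed
qed

lemma app_seq_Cons: "app_seq F (i # is) w = app_seq F is (app_at F i w)"
  by (simp add: app_seq_def)

lemma app_seq_map_Suc:
  "0 \<notin> set is \<Longrightarrow> app_seq F (map Suc is) (a # w) = a # app_seq F is w"
  by (induction "is" arbitrary: w) (simp_all add: app_seq_def app_at_Cons)

lemma sweep_singleton: "sweep F [s] = [s]"
  by (simp add: sweep_def app_seq_def)

text \<open>Only position 1 touches the first letter, so its new value is final at once; the later
  positions are those of a sweep of the tail, shifted by one.\<close>

lemma sweep_Cons_Cons:
  "sweep F (s # t # w) = fst (F (s, t)) # sweep F (snd (F (s, t)) # w)"
proof -
  have "[1..<length (s # t # w)] = 1 # map Suc [1..<length (t # w)]"
    by (simp add: upt_conv_Cons map_Suc_upt del: upt_Suc)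
  then show ?thesis
    using app_at_append[of F "[]" s t w]
    by (simp add: sweep_def app_seq_Cons app_seq_map_Suc del: upt_Suc)
qed

section \<open>Evaluation of words and soundness of relations\<close>

lemma word_value_closed:
  "monoid M \<Longrightarrow> w \<in> lists (carrier M) \<Longrightarrow> word_value M w \<in> carrier M"
  by (induction w) (auto simp: word_value_def intro: monoid.m_closed monoid.one_closed)

lemma word_value_append:
  assumes "monoid M" "u \<in> lists (carrier M)" "v \<in> lists (carrier M)"
  shows "word_value M (u @ v) = word_value M u \<otimes>\<^bsub>M\<^esub> word_value M v"
  using assms(2)
proof (induction u)
  case Nil
  then show ?case
    using monoid.l_one[OF assms(1) word_value_closed[OF assms(1,3)]] by (simp add: word_value_def)
next
  case (Cons a u)
  then show ?case
    using monoid.m_assoc[OF assms(1) _ word_value_closed[OF assms(1), of u]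
        word_value_closed[OF assms(1,3)]]
    by (simp add: word_value_def)
qed

lemma word_value_removeAll_one:
  assumes "monoid M" "w \<in> lists (carrier M)"
  shows "word_value M (removeAll \<one>\<^bsub>M\<^esub> w) = word_value M w"
  using assms(2)
proof (induction w)
  case (Cons a w)
  then show ?case
    using monoid.l_one[OF assms(1) word_value_closed[OF assms(1), of w]]
    by (auto simp: word_value_def)
qed simp

lemma word_cong_in_lists:
  assumes "R \<subseteq> lists X \<times> lists X" "word_cong X R u v"
  shows "u \<in> lists X \<and> v \<in> lists X"
  using assms(2)
proof induction
  case (rel u v)
  then show ?case using assms(1) by blast
qed auto

text \<open>Evaluation turns concatenation into multiplication, so equality of values is itself a
  congruence and it is enough to check the relations.\<close>

lemma word_cong_word_value:
  assumes "monoid M" "X \<subseteq> carrier M" "R \<subseteq> lists X \<times> lists X"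
    and rel: "\<And>u v. (u, v) \<in> R \<Longrightarrow> word_value M u = word_value M v"
    and "word_cong X R u v"
  shows "word_value M u = word_value M v"
  using assms(5)
proof induction
  case (append u u' v v')
  have "u \<in> lists (carrier M)" "u' \<in> lists (carrier M)"
    "v \<in> lists (carrier M)" "v' \<in> lists (carrier M)"
    using append.hyps word_cong_in_lists[OF assms(3)] lists_mono[OF assms(2)] by blast+
  then show ?case using append.IH word_value_append[OF assms(1)] by simp
qed (auto simp: rel)

section \<open>Normalisations and neutral letters\<close>

context normalisation
begin

text \<open>Length preservation leaves exactly two letters, so the projections \<open>!\<close> in
  \<open>Nbar\<close> lose nothing.\<close>

lemma Nbar_list:
  assumes "s \<in> A" "t \<in> A"
  shows "N [s, t] = [fst (Nbar N (s, t)), snd (Nbar N (s, t))]"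
proof -
  have "length (N [s, t]) = 2" using length_preserving[of "[s, t]"] assms by simp
  then show ?thesis by (auto simp: Nbar_def numeral_2_eq_2 length_Suc_conv)
qed

lemma Nbar_in:
  assumes "s \<in> A" "t \<in> A"
  shows "fst (Nbar N (s, t)) \<in> A" "snd (Nbar N (s, t)) \<in> A"
  using closed[of "[s, t]"] assms by (auto simp: Nbar_list)

lemma N_idem: "w \<in> lists A \<Longrightarrow> N (N w) = N w"
  using factor[of "[]" w "[]"] by simp

lemma Nbar_idem:
  assumes "s \<in> A" "t \<in> A"
  shows "Nbar N (Nbar N (s, t)) = Nbar N (s, t)"
proof -
  have "N (N [s, t]) = N [s, t]" using assms by (intro N_idem) auto
  then show ?thesis
    using assms Nbar_list[OF assms] Nbar_list[OF Nbar_in[OF assms]] by (simp add: prod_eq_iff)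
qed

text \<open>This is \<open>factor\<close> with a two-letter middle word; condition (5) will rest on
  it.\<close>

lemma N_app_at:
  assumes "w \<in> lists A" "i \<in> {1..<length w}"
  shows "N (app_at (Nbar N) i w) = N w"
proof -
  obtain a s t b where w: "w = a @ s # t # b" "i = Suc (length a)"
    using assms(2) by (rule split_at_position)
  then show ?thesis
    using factor[of a "[s, t]" b] assms(1) by (auto simp: app_at_append Nbar_list)
qed

lemma N_Cons: "s \<in> A \<Longrightarrow> w \<in> lists A \<Longrightarrow> N (s # N w) = N (s # w)"
  using factor[of "[s]" w "[]"] by simp

text \<open>The letter \<open>e\<close> is first carried to the end of the factor
  \<open>e # v\<close>; then, standing last in the whole word, it splits off from the normal
  form.\<close>

lemma neutral_middle:
  assumes "neutral A N e" "u \<in> lists A" "v \<in> lists A"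
  shows "N (u @ e # v) = N (u @ v) @ [e]"
proof -
  have e: "e \<in> A" "\<And>w. w \<in> lists A \<Longrightarrow> N (w @ [e]) = N w @ [e]"
    "\<And>w. w \<in> lists A \<Longrightarrow> N (e # w) = N w @ [e]"
    using assms(1) by (auto simp: neutral_def)
  have "N (u @ e # v) = N (u @ N (e # v))"
    using factor[of u "e # v" "[]"] assms e(1) by simp
  also have "\<dots> = N ((u @ N v) @ [e])" using assms e(3) by simp
  also have "\<dots> = N (u @ N v) @ [e]" using assms closed[of v] by (intro e(2)) auto
  also have "\<dots> = N (u @ v) @ [e]" using factor[of u v "[]"] assms by simp
  finally show ?thesis .
qed

text \<open>By \<open>neutral_middle\<close>, each \<open>e\<close> in \<open>w\<close> merely adds
  a trailing \<open>e\<close> to the normal form. In the induction the prefix \<open>u\<close>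
  collects the other letters already passed.\<close>

lemma removeAll_N_removeAll:
  assumes "neutral A N e" "u \<in> lists A" "w \<in> lists A"
  shows "removeAll e (N (u @ removeAll e w)) = removeAll e (N (u @ w))"
  using assms(2,3)
proof (induction w arbitrary: u)
  case (Cons a w)
  show ?case
  proof (cases "a = e")
    case True
    then show ?thesis using Cons neutral_middle[OF assms(1), of u w] by simp
  next
    case False
    then show ?thesis using Cons.prems Cons.IH[of "u @ [a]"] by simp
  qed
qed simp

end

section \<open>Quadraticity and the domino rule\<close>

context quadratic_normalisation
begin

lemma N_factor:
  assumes "u @ x # y # v \<in> lists A" "N (u @ x # y # v) = u @ x # y # v"
  shows "N [x, y] = [x, y]"
  using normal_iff[OF assms(1)] assms(2) by auto

text \<open>Normality is a condition on adjacent pairs, so prefixing a letter adds just one pair to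
  check.\<close>

lemma normal_Cons_Cons:
  assumes "x \<in> A" "y \<in> A" "w \<in> lists A"
  shows "N (x # y # w) = x # y # w \<longleftrightarrow> N [x, y] = [x, y] \<and> N (y # w) = y # w"
proof
  assume *: "N (x # y # w) = x # y # w"
  have "N [p, q] = [p, q]" if "y # w = u @ [p, q] @ v" for u p q v
    using N_factor[of "x # u" p q v] * assms that
    by (metis append_Cons append_Nil lists.Cons)
  then show "N [x, y] = [x, y] \<and> N (y # w) = y # w"
    using N_factor[of "[]" x y w] * assms normal_iff[of "y # w"] by auto
next
  assume *: "N [x, y] = [x, y] \<and> N (y # w) = y # w"
  have "N [p, q] = [p, q]" if "x # y # w = u @ [p, q] @ v" for u p q v
  proof (cases u)
    case Nil
    then show ?thesis using * that by simp
  next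
    case (Cons c u')
    then have "y # w = u' @ p # q # v" using that by simp
    then show ?thesis using N_factor[of u' p q v] * assms by (metis lists.Cons)
  qed
  then show "N (x # y # w) = x # y # w" using assms normal_iff[of "x # y # w"] by simp
qed

lemma app_at_normal:
  assumes "w \<in> lists A" "N w = w" "i \<in> {1..<length w}"
  shows "app_at (Nbar N) i w = w"
proof -
  obtain a s t b where w: "w = a @ s # t # b" "i = Suc (length a)"
    using assms(3) by (rule split_at_position)
  have "N [s, t] = [s, t]" using N_factor[of a s t b] assms w by simp
  moreover have "s \<in> A" "t \<in> A" using assms(1) w by auto
  ultimately show ?thesis using w by (simp add: app_at_append Nbar_list)
qed

text \<open>The first application replaces \<open>s\<close>, \<open>x1\<close> by \<open>a\<close>,
  \<open>b\<close>, and by induction the rest of the sweep normalises \<open>b # xs\<close>. What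
  remains is that \<open>a\<close> fits in front of that normal form, which right-class 3 decides on
  the first three letters.\<close>

lemma sweep_eq_N:
  assumes "right_class A N 3" "s \<in> A" "x \<in> lists A" "N x = x"
  shows "sweep (Nbar N) (s # x) = N (s # x)"
  using assms(2-)
proof (induction x arbitrary: s)
  case Nil
  then show ?case by (simp add: sweep_singleton letter)
next
  case (Cons x1 xs)
  let ?F = "Nbar N"
  define a b where "a = fst (?F (s, x1))" and "b = snd (?F (s, x1))"
  have A: "s \<in> A" "x1 \<in> A" "xs \<in> lists A" using Cons.prems by auto
  have ab: "a \<in> A" "b \<in> A" "N [s, x1] = [a, b]"
    using Nbar_in[OF A(1,2)] Nbar_list[OF A(1,2)] by (simp_all add: a_def b_def)
  have "N xs = xs"
  proof (cases xs)
    case Nil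
    then show ?thesis using length_preserving[of "[]"] by simp
  next
    case (Cons x2 ys)
    then show ?thesis using normal_Cons_Cons[of x1 x2 ys] A \<open>N (x1 # xs) = x1 # xs\<close> by simp
  qed
  then have sweep: "sweep ?F (b # xs) = N (b # xs)" using Cons.IH ab A by simp
  have *: "N (a # N (b # xs)) = a # N (b # xs)"
  proof (cases xs)
    case Nil
    then show ?thesis using N_idem[of "[s, x1]"] A ab letter by simp
  next
    case (Cons x2 ys)
    define c d where "c = fst (?F (b, x2))" and "d = snd (?F (b, x2))"
    have A': "x2 \<in> A" "ys \<in> lists A" using A Cons by auto
    have cd: "c \<in> A" "d \<in> A" using Nbar_in[OF ab(2) A'(1)] by (simp_all add: c_def d_def)
    \<comment> \<open>A sweep never returns to its first letter, so the normal form of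
      \<open>b # xs\<close> starts with \<open>c\<close>.\<close>
    have hd: "N (b # xs) = c # sweep ?F (d # ys)"
      using sweep Cons by (simp add: sweep_Cons_Cons c_def d_def)
    have "N (b # xs) \<in> lists A" using A ab by (intro closed) auto
    then have tail: "sweep ?F (d # ys) \<in> lists A" using hd by simp
    \<comment> \<open>The formula of right-class 3 starts at position 2, where the pair is already
      normal. Only positions 1 and 2 remain, exactly as in the sweep.\<close>
    have fix2: "app_at ?F 2 [s, x1, x2] = [s, x1, x2]"
    proof -
      have "N [x1, x2] = [x1, x2]"
        using N_factor[of "[]" x1 x2 ys] Cons A A' \<open>N (x1 # xs) = x1 # xs\<close> by simp
      then show ?thesis
        using app_at_append[of ?F "[s]" x1 x2 "[]"] A A'
        by (simp add: Nbar_list numeral_2_eq_2)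
    qed
    have "N [s, x1, x2] = app_seq ?F [2, 1, 2] [s, x1, x2]"
      using assms(1) A A' by (simp add: right_class_def alternating_def numeral_3_eq_3 upt_rec)
    also have "\<dots> = app_at ?F 2 [a, b, x2]"
      using app_at_append[of ?F "[]" s x1 "[x2]"] fix2
      by (simp add: app_seq_def a_def b_def)
    also have "\<dots> = [a, c, d]"
      using app_at_append[of ?F "[a]" b x2 "[]"] by (simp add: numeral_2_eq_2 c_def d_def)
    \<comment> \<open>A value of \<open>N\<close> is normal, hence so is its factor
      \<open>[a, c]\<close>: the single new pair in front of the tail.\<close>
    finally have "N [a, c, d] = [a, c, d]" using N_idem[of "[s, x1, x2]"] A A' by simp
    then have "N [a, c] = [a, c]" using N_factor[of "[]" a c "[d]"] ab cd by simp
    moreover have "N (N (b # xs)) = N (b # xs)" using A ab by (intro N_idem) auto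
    ultimately show ?thesis using normal_Cons_Cons[OF ab(1) cd(1) tail] hd by simp
  qed
  have "N (s # x1 # xs) = N (a # b # xs)"
    using factor[of "[]" "[s, x1]" xs] A ab by simp
  also have "\<dots> = a # N (b # xs)" using * N_Cons[of a "b # xs"] ab A by simp
  finally show ?case using sweep by (simp add: sweep_Cons_Cons a_def b_def)
qed

section \<open>Computing \<open>Nphi\<close>\<close>

text \<open>A normal word containing \<open>e\<close> must end with \<open>e\<close>, by
  \<open>neutral_middle\<close>. Stripping that letter leaves a shorter value of \<open>N\<close>,
  so induction on the length applies. Thus the tails met by \<open>Nphi\<close> are normal and
  \<open>sweep_eq_N\<close> covers them.\<close>

lemma normal_removeAll:
  assumes "neutral A N e" "w \<in> lists A" "N w = w"
  shows "N (removeAll e w) = removeAll e w"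
  using assms(2,3)
proof (induction w rule: length_induct)
  case (1 w)
  show ?case
  proof (cases "e \<in> set w")
    case True
    then obtain u v where w: "w = u @ e # v" by (meson split_list)
    then have "N w = N (u @ v) @ [e]" using neutral_middle[OF assms(1)] 1 by simp
    then have "w = N (u @ v) @ [e]" using 1 by simp
    moreover define y where "y = N (u @ v)"
    ultimately have y: "w = y @ [e]" by simp
    have "y \<in> lists A" "N y = y"
      using closed[of "u @ v"] N_idem[of "u @ v"] 1 w by (auto simp: y_def)
    then have "N (removeAll e y) = removeAll e y" using 1 y by auto
    then show ?thesis using y by simp
  next
    case False
    then show ?thesis using 1 by simp
  qed
qed

text \<open>The induction follows the recursion of \<open>Nphi\<close>: the tail yields a normal
  word \<open>x\<close>, the sweep of \<open>s # x\<close> is its normal form, and deleting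
  \<open>e\<close> from the tail beforehand changes only the number of trailing letters
  \<open>e\<close>.\<close>

lemma Nphi_eq:
  assumes "right_class A N 3" "neutral A N e" "w \<in> lists A"
  shows "Nphi e (Nbar N) w = removeAll e (N w)"
  using assms
proof (induction e "Nbar N" w rule: Nphi.induct)
  case (1 e)
  then show ?case using length_preserving[of "[]"] by simp
next
  case (2 e s ws)
  have A: "s \<in> A" "ws \<in> lists A" using "2.prems" by auto
  show ?case
  proof (cases "e \<in> set (s # ws)")
    case True
    have "removeAll e (s # ws) \<in> lists A" using A by auto
    then have "Nphi e (Nbar N) (removeAll e (s # ws)) = removeAll e (N (removeAll e (s # ws)))"
      using "2.hyps"(1) True "2.prems" by blast
    also have "\<dots> = removeAll e (N (s # ws))"
      using removeAll_N_removeAll[of e "[]" "s # ws"] "2.prems" by simp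
    finally show ?thesis using True by simp
  next
    case False
    define x where "x = Nphi e (Nbar N) ws"
    have x: "x = removeAll e (N ws)" using "2.hyps"(2) False "2.prems" A by (simp add: x_def)
    have xA: "x \<in> lists A" using closed[of ws] A x by auto
    have "N x = x"
      unfolding x using normal_removeAll[of e "N ws"] closed N_idem A "2.prems" by simp
    then have v: "sweep (Nbar N) (s # x) = N (s # x)"
      using sweep_eq_N "2.prems" A xA by simp
    \<comment> \<open>Here \<open>x\<close> is \<open>N ws\<close> without \<open>e\<close>, so
      \<open>removeAll_N_removeAll\<close> puts the deleted letters back.\<close>
    have "removeAll e (N (s # x)) = removeAll e (N (s # N ws))"
      using removeAll_N_removeAll[of e "[s]" "N ws"] "2.prems" A closed[of ws] x by simp
    then have eq: "removeAll e (N (s # x)) = removeAll e (N (s # ws))" using N_Cons A by simp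
    have vA: "N (s # x) \<in> lists A" using A xA by (intro closed) auto
    show ?thesis
    proof (cases "e \<in> set (N (s # x))")
      case True
      \<comment> \<open>The second pass runs on a word that is already normal, so it only deletes
        \<open>e\<close>.\<close>
      have "Nphi e (Nbar N) (N (s # x)) = removeAll e (N (N (s # x)))"
        by (rule "2.hyps"(3)[OF False]) (use v x_def True "2.prems" vA in auto)
      also have "\<dots> = removeAll e (N (s # ws))" using N_idem[of "s # x"] A xA eq by simp
      finally show ?thesis using False True v by (simp add: x_def[symmetric] Let_def)
    next
      case notin: False
      then show ?thesis using False v eq by (simp add: x_def[symmetric] Let_def)
    qed
  qed
qed

section \<open>Presentation over the letters other than the neutral one\<close>

definition nonneutral_relations :: "'a \<Rightarrow> ('a list \<times> 'a list) set" where
  "nonneutral_relations e =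
    {([s, t], removeAll e [fst (Nbar N (s, t)), snd (Nbar N (s, t))]) |s t.
      s \<in> A - {e} \<and> t \<in> A - {e}}"

lemma nonneutral_relations_in_lists:
  "nonneutral_relations e \<subseteq> lists (A - {e}) \<times> lists (A - {e})"
  using Nbar_in by (auto simp: nonneutral_relations_def)

text \<open>If the rewritten pair contains \<open>e\<close>, then \<open>Nbar N\<close> at most
  moves \<open>e\<close> to the right, which deletion makes invisible; otherwise the step is one of
  the relations, placed in a context. Closure is included so that steps can be iterated.\<close>

lemma word_cong_removeAll_app_at:
  assumes "neutral A N e" "w \<in> lists A" "i \<in> {1..<length w}"
  shows "app_at (Nbar N) i w \<in> lists A \<and>
    word_cong (A - {e}) (nonneutral_relations e)
      (removeAll e w) (removeAll e (app_at (Nbar N) i w))"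
proof -
  let ?C = "word_cong (A - {e}) (nonneutral_relations e)"
  obtain a s t b where w: "w = a @ s # t # b" "i = Suc (length a)"
    using assms(3) by (rule split_at_position)
  let ?f = "[fst (Nbar N (s, t)), snd (Nbar N (s, t))]"
  have A: "s \<in> A" "t \<in> A" "a \<in> lists A" "b \<in> lists A" using assms(2) w by auto
  have refl: "?C (removeAll e u) (removeAll e u)" if "u \<in> lists A" for u
    using that by (intro word_cong.refl) auto
  have N_e: "N [x, e] = [x, e]" "N [e, x] = [x, e]" if "x \<in> A" for x
  proof -
    have "[x] \<in> lists A" using that by simp
    then have "N ([x] @ [e]) = N [x] @ [e] \<and> N (e # [x]) = N [x] @ [e]"
      using assms(1) unfolding neutral_def by (elim conjE) (rule bspec)
    then show "N [x, e] = [x, e]" "N [e, x] = [x, e]" using letter[OF that] by simp_all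
  qed
  have "?C (removeAll e [s, t]) (removeAll e ?f)"
  proof (cases "s = e \<or> t = e")
    case True
    then have "removeAll e (N [s, t]) = removeAll e [s, t]"
    proof
      assume "s = e"
      then show ?thesis using N_e(2)[OF A(2)] by simp
    next
      assume "t = e"
      then show ?thesis using N_e(1)[OF A(1)] by simp
    qed
    then have "removeAll e ?f = removeAll e [s, t]" by (simp only: Nbar_list[OF A(1,2)])
    moreover have "[s, t] \<in> lists A" using A by simp
    ultimately show ?thesis using refl[of "[s, t]"] by (simp only:)
  next
    case False
    then have "([s, t], removeAll e ?f) \<in> nonneutral_relations e"
      using A by (auto simp: nonneutral_relations_def)
    then have "?C [s, t] (removeAll e ?f)" by (rule word_cong.rel)
    moreover have "removeAll e [s, t] = [s, t]" using False by auto
    ultimately show ?thesis by (simp only:)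
  qed
  then have "?C (removeAll e a @ removeAll e [s, t] @ removeAll e b)
      (removeAll e a @ removeAll e ?f @ removeAll e b)"
    using refl A by (intro word_cong.append) auto
  moreover have "app_at (Nbar N) i w = a @ ?f @ b" using w by (simp add: app_at_append)
  moreover from this have
    "removeAll e (app_at (Nbar N) i w) = removeAll e a @ removeAll e ?f @ removeAll e b"
    by simp
  moreover have "a @ ?f @ b \<in> lists A" using A Nbar_in[OF A(1,2)] by simp
  moreover have "removeAll e w = removeAll e a @ removeAll e [s, t] @ removeAll e b"
    using w by simp
  ultimately show ?thesis by (simp only: simp_thms)
qed

text \<open>By \<open>by_positions\<close>, finitely many two-letter steps lead from
  \<open>w\<close> to \<open>N w\<close>; this is why relations between pairs suffice for words of
  any length.\<close>

lemma word_cong_removeAll_N: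
  assumes "neutral A N e" "w \<in> lists A"
  shows "word_cong (A - {e}) (nonneutral_relations e) (removeAll e w) (removeAll e (N w))"
proof -
  have "word_cong (A - {e}) (nonneutral_relations e)
      (removeAll e w) (removeAll e (app_seq (Nbar N) is w))"
    if "set is \<subseteq> {1..<length w}" "w \<in> lists A" for "is" w
    using that
  proof (induction "is" arbitrary: w)
    case Nil
    then show ?case by (auto simp: app_seq_def intro: word_cong.refl)
  next
    case (Cons i "is")
    let ?w = "app_at (Nbar N) i w"
    \<comment> \<open>Unchanged length keeps the remaining positions in range.\<close>
    have "length ?w = length w" by (simp add: app_at_def split: prod.split)
    moreover have "?w \<in> lists A"
      and step: "word_cong (A - {e}) (nonneutral_relations e) (removeAll e w) (removeAll e ?w)"
      using word_cong_removeAll_app_at[OF assms(1) Cons.prems(2), of i] Cons.prems(1) by auto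
    ultimately show ?case
      using word_cong.trans[OF step Cons.IH[of ?w]] Cons.prems(1) by (simp add: app_seq_Cons)
  qed
  then show ?thesis using by_positions[OF assms(2)] assms(2) by metis
qed

text \<open>Deleting 1 maps words over \<open>A\<close> to words over the remaining letters,
  preserves values, and fixes words without 1. Derivations from the given relations are transported
  along it; conversely, the pair relations hold in \<open>M\<close> since \<open>N\<close> preserves
  values.\<close>

lemma presented_by_nonneutral:
  assumes M: "monoid M"
    and "neutral A N \<one>\<^bsub>M\<^esub>"
    and pres: "presented_by M A ({(w, N w) |w. w \<in> lists A} \<union> {([\<one>\<^bsub>M\<^esub>], [])})"
  shows "presented_by M (A - {\<one>\<^bsub>M\<^esub>}) (nonneutral_relations \<one>\<^bsub>M\<^esub>)"
proof -
  let ?e = "\<one>\<^bsub>M\<^esub>" and ?R = "{(w, N w) |w. w \<in> lists A} \<union> {([\<one>\<^bsub>M\<^esub>], [])}"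
  let ?C = "word_cong (A - {?e}) (nonneutral_relations ?e)"
  have sub: "A \<subseteq> carrier M" and surj: "word_value M ` lists A = carrier M"
    and eq: "\<And>u v. u \<in> lists A \<Longrightarrow> v \<in> lists A \<Longrightarrow>
      word_value M u = word_value M v \<longleftrightarrow> word_cong A ?R u v"
    using pres by (auto simp: presented_by_def)
  have lists: "lists A \<subseteq> lists (carrier M)" using sub by auto
  have lists': "lists (A - {?e}) \<subseteq> lists A" by auto
  have value_N: "word_value M (N w) = word_value M w" if "w \<in> lists A" for w
    using eq[OF that closed[OF that]] that by (auto intro: word_cong.rel)
  have "word_value M ` lists (A - {?e}) = carrier M"
  proof
    show "word_value M ` lists (A - {?e}) \<subseteq> carrier M" using surj lists' by blast
    show "carrier M \<subseteq> word_value M ` lists (A - {?e})"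
    proof
      fix m assume "m \<in> carrier M"
      then obtain w where w: "w \<in> lists A" "m = word_value M w" using surj by blast
      then have "m = word_value M (removeAll ?e w)"
        using word_value_removeAll_one[OF M] lists by (metis subsetD)
      moreover have "removeAll ?e w \<in> lists (A - {?e})" using w by auto
      ultimately show "m \<in> word_value M ` lists (A - {?e})" by blast
    qed
  qed
  moreover have "word_value M u = word_value M v \<longleftrightarrow> ?C u v"
    if u: "u \<in> lists (A - {?e})" and v: "v \<in> lists (A - {?e})" for u v
  proof
    \<comment> \<open>The relation that sets the letter 1 equal to the empty word becomes trivial
      after deletion, and \<open>word_cong_removeAll_N\<close> handles the pairs
      \<open>(w, N w)\<close>.\<close>
    have *: "?C (removeAll ?e u) (removeAll ?e v)" if "word_cong A ?R u v" for u v
      using that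
    proof induction
      case (rel u v)
      then show ?case
        using word_cong_removeAll_N[OF assms(2)] by (auto intro: word_cong.refl)
    next
      case (refl w)
      then show ?case by (intro word_cong.refl) auto
    next
      case (append u u' v v')
      then show ?case by (simp add: word_cong.append)
    qed (auto intro: word_cong.sym word_cong.trans)
    assume "word_value M u = word_value M v"
    then have "word_cong A ?R u v" using eq u v lists' by blast
    moreover have "removeAll ?e u = u" "removeAll ?e v = v" using u v by (auto intro: removeAll_id)
    ultimately show "?C u v" using *[of u v] by simp
  next
    have rel: "word_value M u = word_value M v" if uv: "(u, v) \<in> nonneutral_relations ?e" for u v
    proof -
      obtain s t where st: "s \<in> A" "t \<in> A" "u = [s, t]"
        "v = removeAll ?e [fst (Nbar N (s, t)), snd (Nbar N (s, t))]"
        using uv unfolding nonneutral_relations_def by blast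
      then have "v = removeAll ?e (N [s, t])" by (simp add: Nbar_list)
      moreover have "N [s, t] \<in> lists (carrier M)" using closed[of "[s, t]"] st lists by auto
      ultimately show ?thesis
        using word_value_removeAll_one[OF M] value_N[of "[s, t]"] st by simp
    qed
    assume "?C u v"
    then show "word_value M u = word_value M v"
      using word_cong_word_value[OF M _ nonneutral_relations_in_lists rel] sub by blast
  qed
  ultimately show ?thesis
    using sub nonneutral_relations_in_lists by (auto simp: presented_by_def)
qed

end

theorem corollary4p2p1:
  fixes M :: "('a, 'b) monoid_scheme" and S :: "'a set" and N :: "'a list \<Rightarrow> 'a list"
  assumes "monoid M"
    and "generates M S"
    and "\<one>\<^bsub>M\<^esub> \<in> S"
    and "quadratic_normalisation S N"
    and "of_class S N 4 3"
    and "normalisation_mod_1 M S N"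
  shows "local_factorability M S (Nbar N)"
proof -
  interpret quadratic_normalisation S N by fact
  have rc: "right_class S N 3" using assms(5) by (simp add: of_class_def)
  have ne: "neutral S N \<one>\<^bsub>M\<^esub>" and
    pres: "presented_by M S ({(w, N w) |w. w \<in> lists S} \<union> {([\<one>\<^bsub>M\<^esub>], [])})"
    using assms(6) by (auto simp: normalisation_mod_1_def)
  show ?thesis
  proof
    show "Nbar N \<in> S \<times> S \<rightarrow> S \<times> S" using Nbar_in by (auto simp: mem_Times_iff)
    show "presented_by M (S - {\<one>\<^bsub>M\<^esub>})
      {([s, t], removeAll \<one>\<^bsub>M\<^esub> [fst (Nbar N (s, t)), snd (Nbar N (s, t))]) |s t.
        s \<in> S - {\<one>\<^bsub>M\<^esub>} \<and> t \<in> S - {\<one>\<^bsub>M\<^esub>}}"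
      using presented_by_nonneutral[OF assms(1) ne pres] unfolding nonneutral_relations_def .
  next
    fix p assume "p \<in> S \<times> S"
    then show "Nbar N (Nbar N p) = Nbar N p" using Nbar_idem by auto
  next
    fix s assume "s \<in> S - {\<one>\<^bsub>M\<^esub>}"
    then have "N (\<one>\<^bsub>M\<^esub> # [s]) = [s] @ [\<one>\<^bsub>M\<^esub>]" using ne letter[of s] by (simp add: neutral_def)
    then show "Nbar N (\<one>\<^bsub>M\<^esub>, s) = (s, \<one>\<^bsub>M\<^esub>)" by (simp add: Nbar_def)
  next
    fix r s t assume "r \<in> S - {\<one>\<^bsub>M\<^esub>}" "s \<in> S - {\<one>\<^bsub>M\<^esub>}" "t \<in> S - {\<one>\<^bsub>M\<^esub>}"
    then have w: "[r, s, t] \<in> lists S" by simp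
    have N: "N [r, s, t] = app_seq (Nbar N) [2, 1, 2] [r, s, t]"
      using rc w by (simp add: right_class_def alternating_def numeral_3_eq_3 upt_rec)
    \<comment> \<open>The fourth map meets a word that the first three have made normal and so fixes
      it: the first alternative of condition (4) holds.\<close>
    have "app_seq (Nbar N) [2, 1, 2, 1] [r, s, t] = app_at (Nbar N) 1 (N [r, s, t])"
      unfolding N by (simp add: app_seq_def)
    also have "\<dots> = N [r, s, t]"
      using w closed N_idem length_preserving[OF w] by (intro app_at_normal) auto
    finally show "app_seq (Nbar N) [2, 1, 2, 1] [r, s, t] = app_seq (Nbar N) [2, 1, 2] [r, s, t] \<or>
      \<one>\<^bsub>M\<^esub> \<in> set (app_seq (Nbar N) [2, 1, 2] [r, s, t])"
      using N by simp
  next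
    fix r s t assume "r \<in> S" "s \<in> S" "t \<in> S"
    then have w: "[r, s, t] \<in> lists S" by simp
    \<comment> \<open>With this closure \<open>Nphi_eq\<close> applies to both sides of condition
      (5), and \<open>N_app_at\<close> identifies the normal forms.\<close>
    have "app_at (Nbar N) 1 [r, s, t] \<in> lists S"
      using word_cong_removeAll_app_at[OF ne w, of 1] by simp
    then show "Nphi \<one>\<^bsub>M\<^esub> (Nbar N) [r, s, t] = Nphi \<one>\<^bsub>M\<^esub> (Nbar N) (app_at (Nbar N) 1 [r, s, t])"
      using Nphi_eq[OF rc ne] N_app_at[OF w, of 1] w by (simp del: Nphi.simps)
  qed
qed

end
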